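(* Let $f:\mathbb{Z}^{+}\to\mathbb{C}$ be any function and let $g_f(m)=\sum_{d\mid m} f(d)$ for $m\ge 1$. For each integer $m\ge 0$ set $$B_{g_f,m} := g_f(m+1) - \sum_{b=\pm 1}\ \sum_{k=1}^{\left\lfloor \frac{\sqrt{24m+1}-b}{6}\right\rfloor} (-1)^{k+1}\, g_f\!\left(m+1-\frac{k(3k+b)}{2}\right).$$ Then for all $n\ge 1$, $$\begin{bmatrix} f(1)\\ f(2)\\ \vdots\\ f(n)\end{bmatrix} = A_n^{-1}\begin{bmatrix} B_{g_f,0}\\ B_{g_f,1}\\ \vdots\\ B_{g_f,n-1}\end{bmatrix},$$ where $A_n=(a_{i,j})_{1\le i,j\le n}$ is the $n\times n$ matrix whose entries are the numbers $a_{i,j}$ defined in the context.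
   Context: The pair $(f,g_f)$ is related by the Lambert series $\sum_{n\ge1} \frac{f(n)q^n}{1-q^n}=\sum_{m\ge1} g_f(m)q^m$ (equivalently $g_f(m)=\sum_{d\mid m}f(d)$). Iverson bracket: $[P]_\delta=1$ if the condition $P$ is true and $0$ otherwise. For integers $n,i\ge 1$ define $$a_{n,i} = \sum_{b=\pm1}\ \sum_{s=0}^{\lfloor n/i\rfloor-1} (-1)^{\left\lfloor \frac{\sqrt{24(n-(s+1)i)+1}-b}{6}\right\rfloor}\left[\frac{\sqrt{24(n-(s+1)i)+1}-b}{6}\in\mathbb{Z}\right]_\delta ,$$ i.e. $a_{n,i}$ is the sum of $(-1)^k$ over all ways of writing $n=(s+1)i+\frac{k(3k\pm1)}{2}$ with integers $k,s\ge0$ (for each $s$, the value $k=0$ is counted only once, not once for each sign). Empty sums are $0$, so $a_{n,i}=0$ for $i>n$. The matrix $A_n=(a_{i,j})_{1\le i,j\le n}$ (row index $i$, column index $j$) is lower triangular with ones on its diagonal, hence invertible, and $A_n^{-1}$ denotes its inverse. *)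

theory Defs
  imports Complex_Main "Jordan_Normal_Form.Gauss_Jordan_Elimination"
begin

text \<open>Functions on the positive integers are total functions on \<^typ>\<open>nat\<close> whose value at 0 is
  irrelevant: all divisors of \<open>m \<ge> 1\<close> are positive.\<close>

definition divisor_sum :: "(nat \<Rightarrow> complex) \<Rightarrow> nat \<Rightarrow> complex" where
  "divisor_sum f m = (\<Sum>d | d dvd m. f d)"

text \<open>Solves \<open>x = k (3 k + b) / 2\<close> for \<open>k\<close>, as the larger root, i.e. the \<open>k\<close> with
  \<open>6 k + b = sqrt (24 x + 1)\<close>; it is nonnegative for \<open>x \<ge> 0\<close> and \<open>b = 1\<close> or \<open>b = -1\<close>.\<close>

definition pent_root :: "int \<Rightarrow> real \<Rightarrow> real" where
  "pent_root b x = (sqrt (24 * x + 1) - real_of_int b) / 6"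

text \<open>For \<open>i \<ge> 1\<close> the index \<open>s\<close> runs from 0 to \<open>floor (n / i) - 1\<close>, so \<open>n - (s + 1) i \<ge> 0\<close> and
  the exponent is a nonnegative integer. The Iverson bracket is \<^const>\<open>of_bool\<close>.\<close>

definition a_coeff :: "nat \<Rightarrow> nat \<Rightarrow> int" where
  "a_coeff n i = (\<Sum>b\<in>{1, -1}. \<Sum>s<n div i.
     (-1) ^ nat \<lfloor>pent_root b (real n - (real s + 1) * real i)\<rfloor>
       * of_bool (pent_root b (real n - (real s + 1) * real i) \<in> \<int>))"

text \<open>Matrices and vectors are 0-based, hence the index shifts.\<close>

definition A_mat :: "nat \<Rightarrow> complex mat" where
  "A_mat n = mat n n (\<lambda>(i, j). of_int (a_coeff (i + 1) (j + 1)))"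

text \<open>The product \<open>k (3 k + b)\<close> is even for odd \<open>b\<close>, so \<open>div 2\<close> is exact. In the range of
  summation \<open>k (3 k + b) / 2 \<le> m\<close>, so the argument of \<open>g\<close> is at least 1 and \<^const>\<open>nat\<close> does
  not truncate.\<close>

definition B_coeff :: "(nat \<Rightarrow> complex) \<Rightarrow> nat \<Rightarrow> complex" where
  "B_coeff g m = g (m + 1) -
     (\<Sum>b\<in>{1, -1}. \<Sum>k\<in>{1..\<lfloor>pent_root b (real m)\<rfloor>}.
        (-1) ^ nat (k + 1) * g (nat (int m + 1 - k * (3 * k + b) div 2)))"

end

theory Submission
  imports Defs "Jordan_Normal_Form.Determinant"
begin

text \<open>
  The number \<open>a\<^sub>n\<^sub>,\<^sub>i\<close> is a sum of values of one arithmetic function: if \<open>\<epsilon>(x)\<close> denotes the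
  sum of \<open>(-1)^k\<close> over the representations \<open>x = k (3 k \<plusminus> 1) / 2\<close> with \<open>k \<ge> 0\<close>, where \<open>k = 0\<close> is
  counted once, then \<open>a\<^sub>n\<^sub>,\<^sub>i\<close> is the sum of
  \<open>\<epsilon>(x)\<close> over those \<open>x < n\<close> for which \<open>i\<close> divides \<open>n - x\<close> (lemma \<open>a_coeff_eq_sum\<close>). On the other
  hand, solving \<open>x = k (3 k + b) / 2\<close> for \<open>k\<close> turns the double sum that defines \<open>B\<^sub>g\<^sub>,\<^sub>m\<close> into the
  convolution of \<open>\<epsilon>\<close> with \<open>g\<close> (lemma \<open>B_coeff_eq_convolution\<close>).

  For \<open>g(m)\<close> the sum of \<open>f(d)\<close> over the divisors \<open>d\<close> of \<open>m\<close>, exchanging the order of summation in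
  this convolution collects the coefficient \<open>a\<^sub>n\<^sub>,\<^sub>d\<close> in front of \<open>f(d)\<close>, so that \<open>A\<^sub>n\<close> maps the vector
  of values of \<open>f\<close> to the vector of the \<open>B\<^sub>g\<^sub>,\<^sub>m\<close> (lemma \<open>B_coeff_divisor_sum\<close>). The matrix is lower
  triangular with unit diagonal, hence invertible, and the claim follows. The
  pentagonal number theorem is not needed: the convolution identity is a mere reindexing, and
  \<open>\<epsilon>(0) = 1\<close> accounts for the leading term \<open>g(m + 1)\<close> and for the unit diagonal.
\<close>

section \<open>Signed representations by generalised pentagonal numbers\<close>

text \<open>The contribution of the sign \<open>b\<close> to \<open>\<epsilon>(x)\<close>: it is \<open>(-1)^k\<close> if \<open>x = k (3 k + b) / 2\<close> for the
  larger root \<open>k\<close>, and 0 if that root is not an integer.\<close>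

definition pent_sign :: "int \<Rightarrow> nat \<Rightarrow> int" where
  "pent_sign b x = (-1) ^ nat \<lfloor>pent_root b (real x)\<rfloor> * of_bool (pent_root b (real x) \<in> \<int>)"

text \<open>The generalised pentagonal number \<open>k (3 k + b) / 2\<close>. It is used for \<open>k \<ge> 1\<close> and \<open>b\<close> equal to 1
  or -1, where the division is exact and \<^const>\<open>nat\<close> does not truncate.\<close>

definition pent_number :: "int \<Rightarrow> int \<Rightarrow> nat" where
  "pent_number b k = nat (k * (3 * k + b) div 2)"

lemma pent_number_pos:
  assumes "b \<in> {1, -1}" "k \<ge> 1"
  shows "pent_number b k \<ge> 1"
proof -
  have "1 * 2 \<le> k * (3 * k + b)"
    using assms by (intro mult_mono) auto
  then show ?thesis
    by (simp add: pent_number_def le_nat_iff)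
qed

lemma two_times_pent_number:
  assumes "b \<in> {1, -1}" "k \<ge> 1"
  shows "2 * int (pent_number b k) = k * (3 * k + b)"
proof -
  have "even (k * (3 * k + b))"
    using assms(1) by auto
  moreover have "k * (3 * k + b) \<ge> 0"
    using assms by auto
  ultimately show ?thesis
    by (auto simp: pent_number_def)
qed

text \<open>Completing the square: \<open>24 k (3 k + b) / 2 + 1 = (6 k + b)^2\<close> because \<open>b^2 = 1\<close>.\<close>

lemma pent_root_pent_number:
  assumes "b \<in> {1, -1}" "k \<ge> 1"
  shows "pent_root b (real (pent_number b k)) = real_of_int k"
proof -
  have "real_of_int (2 * int (pent_number b k)) = real_of_int (k * (3 * k + b))"
    by (simp only: two_times_pent_number[OF assms])
  then have "24 * real (pent_number b k) + 1 = (6 * real_of_int k + real_of_int b)\<^sup>2"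
    using assms(1) by (auto simp: power2_eq_square algebra_simps)
  moreover have "6 * real_of_int k + real_of_int b \<ge> 0"
    using assms by auto
  ultimately show ?thesis
    by (simp add: pent_root_def)
qed

lemma pent_number_le_iff:
  assumes "b \<in> {1, -1}" "k \<ge> 1"
  shows "pent_number b k \<le> m \<longleftrightarrow> k \<le> \<lfloor>pent_root b (real m)\<rfloor>"
proof -
  have "pent_number b k \<le> m \<longleftrightarrow> pent_root b (real (pent_number b k)) \<le> pent_root b (real m)"
    by (simp add: pent_root_def)
  also have "\<dots> \<longleftrightarrow> k \<le> \<lfloor>pent_root b (real m)\<rfloor>"
    by (simp add: pent_root_pent_number[OF assms] le_floor_iff)
  finally show ?thesis .
qed

lemma pent_root_pos:
  assumes "b \<in> {1, -1}" "x \<ge> (1 :: nat)"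
  shows "pent_root b (real x) > 0"
proof -
  have "1 < sqrt (24 * real x + 1)"
    using assms(2) by simp
  then show ?thesis
    using assms(1) by (auto simp: pent_root_def simp del: real_sqrt_gt_1_iff)
qed

lemma pent_number_of_root:
  assumes b: "b \<in> {1, -1}" and x: "x \<ge> (1 :: nat)" and int: "pent_root b (real x) \<in> \<int>"
  shows "\<lfloor>pent_root b (real x)\<rfloor> \<ge> 1" "pent_number b \<lfloor>pent_root b (real x)\<rfloor> = x"
proof -
  define k where "k = \<lfloor>pent_root b (real x)\<rfloor>"
  have k: "pent_root b (real x) = real_of_int k"
    using int by (auto simp: k_def elim: Ints_cases)
  have k1: "k \<ge> 1"
    using pent_root_pos[OF b x] unfolding k by simp
  have "pent_root b (real (pent_number b k)) = pent_root b (real x)"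
    using pent_root_pent_number[OF b k1] k by simp
  then have "pent_number b k = x"
    by (simp add: pent_root_def)
  with k1 show "\<lfloor>pent_root b (real x)\<rfloor> \<ge> 1" "pent_number b \<lfloor>pent_root b (real x)\<rfloor> = x"
    by (simp_all add: k_def)
qed

text \<open>The representation of 0 with \<open>k = 0\<close> is attributed to \<open>b = 1\<close> alone: for \<open>b = -1\<close> the larger
  root is \<open>1/3\<close>.\<close>

lemma pent_sign_0: "pent_sign 1 0 = 1" "pent_sign (-1) 0 = 0"
proof -
  have "(1/3 :: real) \<notin> \<int>"
  proof
    assume "(1/3 :: real) \<in> \<int>"
    then obtain k where "(1/3 :: real) = of_int k"
      by (elim Ints_cases)
    then have "real_of_int (3 * k) = real_of_int 1"
      by simp
    then have "3 * k = 1"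
      by (simp only: of_int_eq_iff)
    then show False
      by presburger
  qed
  then show "pent_sign 1 0 = 1" "pent_sign (-1) 0 = 0"
    by (simp_all add: pent_sign_def pent_root_def)
qed

section \<open>The coefficients as sums over signs\<close>

text \<open>For \<open>x \<ge> 1\<close>, the maps \<^const>\<open>pent_number\<close> and \<^const>\<open>pent_root\<close> are mutually inverse between the
  positive integers \<open>k\<close> and the \<open>x\<close> whose root is an integer. This matches the summation over \<open>x\<close>
  with the summation over \<open>k\<close>.\<close>

lemma sum_pent_sign:
  fixes G :: "nat \<Rightarrow> 'a :: comm_ring_1"
  assumes b: "b \<in> {1, -1}"
  shows "(\<Sum>x\<in>{1..m}. of_int (pent_sign b x) * G x) =
    (\<Sum>k\<in>{1..\<lfloor>pent_root b (real m)\<rfloor>}. (-1) ^ nat k * G (pent_number b k))"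
proof -
  have "(\<Sum>x\<in>{1..m}. of_int (pent_sign b x) * G x) =
      (\<Sum>x\<in>{x\<in>{1..m}. pent_root b (real x) \<in> \<int>}. of_int (pent_sign b x) * G x)"
    by (rule sum.mono_neutral_right) (auto simp: pent_sign_def)
  also have "\<dots> = (\<Sum>k\<in>{1..\<lfloor>pent_root b (real m)\<rfloor>}. (-1) ^ nat k * G (pent_number b k))"
  proof (rule sum.reindex_bij_witness[where i = "pent_number b"
        and j = "\<lambda>x. \<lfloor>pent_root b (real x)\<rfloor>"])
    fix x assume "x \<in> {x\<in>{1..m}. pent_root b (real x) \<in> \<int>}"
    then have x: "x \<ge> 1" "x \<le> m" and int: "pent_root b (real x) \<in> \<int>"
      by auto
    note k = pent_number_of_root[OF b x(1) int]
    show "pent_number b \<lfloor>pent_root b (real x)\<rfloor> = x"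
      by (rule k)
    show "\<lfloor>pent_root b (real x)\<rfloor> \<in> {1..\<lfloor>pent_root b (real m)\<rfloor>}"
      using pent_number_le_iff[OF b k(1), of m] k x(2) by simp
    show "(-1) ^ nat \<lfloor>pent_root b (real x)\<rfloor> * G (pent_number b \<lfloor>pent_root b (real x)\<rfloor>) =
        of_int (pent_sign b x) * G x"
      using int by (simp add: pent_sign_def k(2))
  next
    fix k assume "k \<in> {1..\<lfloor>pent_root b (real m)\<rfloor>}"
    then have k: "k \<ge> 1" "k \<le> \<lfloor>pent_root b (real m)\<rfloor>"
      by auto
    note root = pent_root_pent_number[OF b k(1)]
    show "\<lfloor>pent_root b (real (pent_number b k))\<rfloor> = k"
      by (simp add: root)
    show "pent_number b k \<in> {x\<in>{1..m}. pent_root b (real x) \<in> \<int>}"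
      using pent_number_pos[OF b k(1)] pent_number_le_iff[OF b k(1), of m] k(2)
      by (simp add: root)
  qed
  finally show ?thesis .
qed

lemma B_coeff_eq_convolution:
  "B_coeff g m = (\<Sum>x<m + 1. of_int (\<Sum>b\<in>{1, -1}. pent_sign b x) * g (m + 1 - x))"
proof -
  have inner: "(\<Sum>k\<in>{1..\<lfloor>pent_root b (real m)\<rfloor>}.
        (-1) ^ nat (k + 1) * g (nat (int m + 1 - k * (3 * k + b) div 2))) =
      - (\<Sum>x\<in>{1..m}. of_int (pent_sign b x) * g (m + 1 - x))" if b: "b \<in> {1, -1}" for b
  proof -
    have "(-1) ^ nat (k + 1) * g (nat (int m + 1 - k * (3 * k + b) div 2)) =
        - ((-1) ^ nat k * g (m + 1 - pent_number b k))"
      if "k \<in> {1..\<lfloor>pent_root b (real m)\<rfloor>}" for k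
    proof -
      have "k \<ge> 1"
        using that by simp
      then have "int (pent_number b k) = k * (3 * k + b) div 2"
        using two_times_pent_number[OF b] by (metis nonzero_mult_div_cancel_left zero_neq_numeral)
      then have "nat (int m + 1 - k * (3 * k + b) div 2) = m + 1 - pent_number b k"
        by linarith
      moreover have "nat (k + 1) = Suc (nat k)"
        using \<open>k \<ge> 1\<close> by simp
      ultimately show ?thesis
        by simp
    qed
    then have "(\<Sum>k\<in>{1..\<lfloor>pent_root b (real m)\<rfloor>}.
        (-1) ^ nat (k + 1) * g (nat (int m + 1 - k * (3 * k + b) div 2))) =
        (\<Sum>k\<in>{1..\<lfloor>pent_root b (real m)\<rfloor>}. - ((-1) ^ nat k * g (m + 1 - pent_number b k)))"
      by (intro sum.cong refl)
    also have "\<dots> = - (\<Sum>x\<in>{1..m}. of_int (pent_sign b x) * g (m + 1 - x))"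
      by (simp only: sum_negf sum_pent_sign[OF b])
    finally show ?thesis .
  qed
  have "B_coeff g m = g (m + 1) +
      (\<Sum>b\<in>{1, -1}. \<Sum>x\<in>{1..m}. of_int (pent_sign b x) * g (m + 1 - x))"
    unfolding B_coeff_def by (simp add: inner)
  also have "\<dots> = g (m + 1) +
      (\<Sum>x\<in>{1..m}. of_int (\<Sum>b\<in>{1, -1}. pent_sign b x) * g (m + 1 - x))"
    by (simp add: sum.distrib algebra_simps)
  also have "\<dots> = (\<Sum>x\<in>insert 0 {1..m}.
      of_int (\<Sum>b\<in>{1, -1}. pent_sign b x) * g (m + 1 - x))"
    by (subst sum.insert) (simp_all add: pent_sign_0)
  also have "insert 0 {1..m} = {..<m + 1}"
    by auto
  finally show ?thesis .
qed

text \<open>The substitution is \<open>x = n - (s + 1) i\<close>: the positive multiples of \<open>i\<close> up to \<open>n\<close> are the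
  \<open>n - x\<close> with \<open>x < n\<close> that \<open>i\<close> divides.\<close>

lemma a_coeff_eq_sum:
  assumes "i \<ge> 1"
  shows "a_coeff n i = (\<Sum>x | x < n \<and> i dvd n - x. \<Sum>b\<in>{1, -1}. pent_sign b x)"
proof -
  have bound: "(s + 1) * i \<le> n" if "s < n div i" for s
    using that assms by (metis Suc_eq_plus1 Suc_leI div_times_less_eq_dividend le_trans mult_le_mono1)
  have "a_coeff n i = (\<Sum>b\<in>{1, -1}. \<Sum>s<n div i. pent_sign b (n - (s + 1) * i))"
    unfolding a_coeff_def
  proof (intro sum.cong refl)
    fix b s assume "s \<in> {..<n div i}"
    then have "real n - (real s + 1) * real i = real (n - (s + 1) * i)"
      using bound[of s] by (simp add: of_nat_diff algebra_simps)
    then show "(-1) ^ nat \<lfloor>pent_root b (real n - (real s + 1) * real i)\<rfloor>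
        * of_bool (pent_root b (real n - (real s + 1) * real i) \<in> \<int>) =
        pent_sign b (n - (s + 1) * i)"
      by (simp add: pent_sign_def)
  qed
  also have "\<dots> = (\<Sum>s<n div i. \<Sum>b\<in>{1, -1}. pent_sign b (n - (s + 1) * i))"
    by (rule sum.swap)
  also have "\<dots> = (\<Sum>x | x < n \<and> i dvd n - x. \<Sum>b\<in>{1, -1}. pent_sign b x)"
  proof (rule sum.reindex_bij_witness[where i = "\<lambda>x. (n - x) div i - 1"
        and j = "\<lambda>s. n - (s + 1) * i"])
    fix s assume "s \<in> {..<n div i}"
    then have le: "(s + 1) * i \<le> n"
      using bound by simp
    then have diff: "n - (n - (s + 1) * i) = (s + 1) * i"
      by simp
    show "(n - (n - (s + 1) * i)) div i - 1 = s"
      unfolding diff using assms by simp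
    have "(s + 1) * i > 0"
      using assms by simp
    then have "n - (s + 1) * i < n"
      using le by linarith
    then show "n - (s + 1) * i \<in> {x. x < n \<and> i dvd n - x}"
      unfolding mem_Collect_eq diff by simp
  next
    fix x assume "x \<in> {x. x < n \<and> i dvd n - x}"
    then obtain c where x: "x < n" and c: "n - x = i * c"
      by (auto elim: dvdE)
    have c1: "c \<ge> 1"
      using x c by (cases c) auto
    have quot: "(n - x) div i = c"
      using c assms by simp
    show "n - ((n - x) div i - 1 + 1) * i = x"
      unfolding quot using c c1 x by (simp add: mult.commute)
    have "c \<le> n div i"
      using quot by (metis diff_le_self div_le_mono)
    then show "(n - x) div i - 1 \<in> {..<n div i}"
      unfolding quot using c1 by auto
  qed simp
  finally show ?thesis .
qed

section \<open>The linear system\<close>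

lemma B_coeff_divisor_sum:
  assumes "m < n"
  shows "B_coeff (divisor_sum f) m = (\<Sum>d = 1..n. of_int (a_coeff (m + 1) d) * f d)"
proof -
  define e :: "nat \<Rightarrow> complex" where "e x = of_int (\<Sum>b\<in>{1, -1}. pent_sign b x)" for x
  have "B_coeff (divisor_sum f) m = (\<Sum>x<m + 1. \<Sum>d | d dvd m + 1 - x. e x * f d)"
    by (simp add: B_coeff_eq_convolution e_def divisor_sum_def sum_distrib_left)
  \<comment> \<open>The divisors of \<open>m + 1 - x \<le> n\<close> lie in a range independent of \<open>x\<close>, so the sums can be swapped.\<close>
  also have "\<dots> = (\<Sum>x<m + 1. \<Sum>d | d \<in> {1..n} \<and> d dvd m + 1 - x. e x * f d)"
  proof (intro sum.cong refl)
    fix x assume x: "x \<in> {..<m + 1}"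
    have "d \<in> {1..n}" if "d dvd m + 1 - x" for d
      using that x assms dvd_imp_le[OF that] by (cases d) auto
    then show "{d. d dvd m + 1 - x} = {d. d \<in> {1..n} \<and> d dvd m + 1 - x}"
      by blast
  qed
  also have "\<dots> = (\<Sum>d = 1..n. \<Sum>x | x \<in> {..<m + 1} \<and> d dvd m + 1 - x. e x * f d)"
    by (rule sum.swap_restrict) auto
  also have "\<dots> = (\<Sum>d = 1..n. of_int (a_coeff (m + 1) d) * f d)"
    by (intro sum.cong refl) (simp add: a_coeff_eq_sum e_def sum_distrib_right)
  finally show ?thesis .
qed

lemma A_mat_mult_vec:
  "A_mat n *\<^sub>v vec n (\<lambda>i. f (i + 1)) = vec n (\<lambda>i. B_coeff (divisor_sum f) i)"
proof (rule eq_vecI)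
  fix i assume "i < dim_vec (vec n (\<lambda>i. B_coeff (divisor_sum f) i))"
  then have i: "i < n"
    by simp
  have "(A_mat n *\<^sub>v vec n (\<lambda>i. f (i + 1))) $ i =
      (\<Sum>j<n. of_int (a_coeff (i + 1) (j + 1)) * f (j + 1))"
    using i by (simp add: A_mat_def scalar_prod_def lessThan_atLeast0)
  also have "\<dots> = (\<Sum>d = 1..n. of_int (a_coeff (i + 1) d) * f d)"
    by (rule sum.reindex_bij_witness[where i = "\<lambda>d. d - 1" and j = "\<lambda>j. j + 1"]) auto
  finally show "(A_mat n *\<^sub>v vec n (\<lambda>i. f (i + 1))) $ i =
      vec n (\<lambda>i. B_coeff (divisor_sum f) i) $ i"
    using i by (simp add: B_coeff_divisor_sum)
qed (simp add: A_mat_def)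

lemma a_coeff_eq_0: "n < i \<Longrightarrow> a_coeff n i = 0"
  by (simp add: a_coeff_def)

lemma a_coeff_diag:
  assumes "n \<ge> 1"
  shows "a_coeff n n = 1"
proof -
  have "{x. x < n \<and> n dvd n - x} = {0}"
    using assms by (auto dest: dvd_imp_le)
  then show ?thesis
    using assms by (simp add: a_coeff_eq_sum pent_sign_0)
qed

lemma det_A_mat: "det (A_mat n) = 1"
proof -
  have "det (A_mat n) = prod_list (diag_mat (A_mat n))"
    by (rule det_lower_triangular[where n = n]) (auto simp: A_mat_def a_coeff_eq_0)
  also have "diag_mat (A_mat n) = replicate n 1"
    by (rule nth_equalityI) (auto simp: diag_mat_def A_mat_def a_coeff_diag)
  finally show ?thesis
    by simp
qed

theorem theorem1p3:
  fixes f :: "nat \<Rightarrow> complex" and n :: nat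
  assumes "n \<ge> 1"
  shows "\<exists>A_inv. mat_inverse (A_mat n) = Some A_inv \<and>
    vec n (\<lambda>i. f (i + 1)) = A_inv *\<^sub>v vec n (\<lambda>i. B_coeff (divisor_sum f) i)"
proof -
  have carrier: "A_mat n \<in> carrier_mat n n"
    by (simp add: A_mat_def)
  have "A_mat n \<in> Units (ring_mat TYPE(complex) n ())"
    by (rule det_non_zero_imp_unit[OF carrier]) (simp add: det_A_mat)
  then obtain C where C: "mat_inverse (A_mat n) = Some C"
    using mat_inverse(1)[OF carrier, of "()"] by (cases "mat_inverse (A_mat n)") auto
  have inv: "C * A_mat n = 1\<^sub>m n" "C \<in> carrier_mat n n"
    using mat_inverse(2)[OF carrier C] by auto
  let ?v = "vec n (\<lambda>i. f (i + 1))"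
  have "C *\<^sub>v vec n (\<lambda>i. B_coeff (divisor_sum f) i) = C *\<^sub>v (A_mat n *\<^sub>v ?v)"
    by (simp only: A_mat_mult_vec)
  also have "\<dots> = (C * A_mat n) *\<^sub>v ?v"
    by (rule assoc_mult_mat_vec[symmetric, OF inv(2) carrier]) simp
  also have "\<dots> = ?v"
    by (simp add: inv(1))
  finally show ?thesis
    using C by auto
qed

end
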